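(* Let $\tilde{\mathbb{E}}[\cdot]$ be a nonlinear expectation dominated by a sublinear expectation $\hat{\mathbb{E}}[\cdot]$ on $(\Omega,\mathcal{H})$, and let $(X_1,Y_1)$ be a $2d$-dimensional random vector ($X_1$ and $Y_1$ each $d$-dimensional) satisfying $$\lim_{N\to\infty}\hat{\mathbb{E}}\left[(|X_1|^2-N)^++(|Y_1|-N)^+\right]=0.$$ Suppose that for each $(A,p)\in\mathbb{S}_d\times\mathbb{R}^d$ the limit $$\tilde{G}(A,p):=\lim_{n\to\infty}n\,\tilde{\mathbb{E}}\left[\frac1n\left(\tfrac12\langle AX_1,X_1\rangle+\langle p,Y_1\rangle\right)\right]$$ exists. Then for each $(A,p)\in\mathbb{S}_d\times\mathbb{R}^d$, $$\tilde{G}(\lambda A,\lambda p)=\lambda\tilde{G}(A,p)\quad\text{for all }\lambda\ge0.$$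
   Context: $C_{b.Lip}(\mathbb{R}^n)$ is the space of bounded Lipschitz functions on $\mathbb{R}^n$; $\mathbb{S}_d$ is the space of real symmetric $d\times d$ matrices; $a^+=\max(a,0)$. Let $\Omega$ be a nonempty set and $\mathcal{H}$ a linear space of real functions on $\Omega$ such that $|\xi|\in\mathcal{H}$ if $\xi\in\mathcal{H}$, and $\phi(\xi_1,\ldots,\xi_n)\in\mathcal{H}$ for all $n$, $\phi\in C_{b.Lip}(\mathbb{R}^n)$, $\xi_i\in\mathcal{H}$. A nonlinear expectation is a map $\tilde{\mathbb{E}}:\mathcal{H}\to\mathbb{R}$ with $\tilde{\mathbb{E}}[\xi_1]\ge\tilde{\mathbb{E}}[\xi_2]$ whenever $\xi_1\ge\xi_2$, and $\tilde{\mathbb{E}}[c]=c$ for $c\in\mathbb{R}$. A sublinear expectation is a nonlinear expectation $\hat{\mathbb{E}}$ with $\hat{\mathbb{E}}[\xi_1+\xi_2]\le\hat{\mathbb{E}}[\xi_1]+\hat{\mathbb{E}}[\xi_2]$ and $\hat{\mathbb{E}}[\lambda\xi]=\lambda\hat{\mathbb{E}}[\xi]$ for $\lambda\ge0$. $\tilde{\mathbb{E}}$ is dominated by $\hat{\mathbb{E}}$ if $\tilde{\mathbb{E}}[\xi_1]-\tilde{\mathbb{E}}[\xi_2]\le\hat{\mathbb{E}}[\xi_1-\xi_2]$ for all $\xi_1,\xi_2\in\mathcal{H}$. $L^1(\Omega)$ is the completion of $\mathcal{H}$ under $\|\xi\|=\hat{\mathbb{E}}[|\xi|]$; $\hat{\mathbb{E}}$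 and every dominated $\tilde{\mathbb{E}}$ extend continuously to $L^1(\Omega)$ and domination still holds there. Random vectors have components in $L^1(\Omega)$, and the quantities appearing inside expectations (such as $|X_1|^2$, $|Y_1|$, $\langle AX_1,X_1\rangle$) are elements of $L^1(\Omega)$ (under the uniform integrability hypothesis they are the $L^1$-limits of the same expressions with $X_1,Y_1$ truncated). *)

theory Defs
  imports "HOL-Analysis.Analysis" "HOL-Library.Going_To_Filter"
begin

section \<open>Sublinear expectation spaces\<close>

text \<open>Bounded Lipschitz functions of \<open>n\<close> real variables.  A point of \<open>n\<close>-space is given by the
  values of \<open>x :: nat \<Rightarrow> real\<close> at \<open>0, \<dots>, n - 1\<close>; the Lipschitz condition forces \<open>\<phi>\<close> to ignore
  the other values.\<close>

definition Cb_Lip :: "nat \<Rightarrow> ((nat \<Rightarrow> real) \<Rightarrow> real) set" where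
  "Cb_Lip n = {\<phi>. (\<exists>C. \<forall>x. \<bar>\<phi> x\<bar> \<le> C) \<and>
     (\<exists>L. \<forall>x y. \<bar>\<phi> x - \<phi> y\<bar> \<le> L * L2_set (\<lambda>i. x i - y i) {..<n})}"

definition random_variable_space :: "('w \<Rightarrow> real) set \<Rightarrow> bool" where
  "random_variable_space H \<longleftrightarrow>
     (\<lambda>_. 0) \<in> H \<and>
     (\<forall>\<xi>\<in>H. \<forall>\<eta>\<in>H. (\<lambda>\<omega>. \<xi> \<omega> + \<eta> \<omega>) \<in> H) \<and>
     (\<forall>c. \<forall>\<xi>\<in>H. (\<lambda>\<omega>. c * \<xi> \<omega>) \<in> H) \<and>
     (\<forall>\<xi>\<in>H. (\<lambda>\<omega>. \<bar>\<xi> \<omega>\<bar>) \<in> H) \<and>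
     (\<forall>n. \<forall>\<phi>\<in>Cb_Lip n. \<forall>\<xi>. (\<forall>i<n. \<xi> i \<in> H) \<longrightarrow> (\<lambda>\<omega>. \<phi> (\<lambda>i. \<xi> i \<omega>)) \<in> H)"

definition nonlinear_expectation :: "('w \<Rightarrow> real) set \<Rightarrow> (('w \<Rightarrow> real) \<Rightarrow> real) \<Rightarrow> bool" where
  "nonlinear_expectation H E \<longleftrightarrow>
     (\<forall>\<xi>\<in>H. \<forall>\<eta>\<in>H. (\<forall>\<omega>. \<xi> \<omega> \<ge> \<eta> \<omega>) \<longrightarrow> E \<xi> \<ge> E \<eta>) \<and>
     (\<forall>c. E (\<lambda>_. c) = c)"

definition sublinear_expectation :: "('w \<Rightarrow> real) set \<Rightarrow> (('w \<Rightarrow> real) \<Rightarrow> real) \<Rightarrow> bool" where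
  "sublinear_expectation H E \<longleftrightarrow>
     nonlinear_expectation H E \<and>
     (\<forall>\<xi>\<in>H. \<forall>\<eta>\<in>H. E (\<lambda>\<omega>. \<xi> \<omega> + \<eta> \<omega>) \<le> E \<xi> + E \<eta>) \<and>
     (\<forall>c\<ge>0. \<forall>\<xi>\<in>H. E (\<lambda>\<omega>. c * \<xi> \<omega>) = c * E \<xi>)"

definition dominated_by ::
  "('w \<Rightarrow> real) set \<Rightarrow> (('w \<Rightarrow> real) \<Rightarrow> real) \<Rightarrow> (('w \<Rightarrow> real) \<Rightarrow> real) \<Rightarrow> bool" where
  "dominated_by H E E' \<longleftrightarrow> (\<forall>\<xi>\<in>H. \<forall>\<eta>\<in>H. E \<xi> - E \<eta> \<le> E' (\<lambda>\<omega>. \<xi> \<omega> - \<eta> \<omega>))"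


section \<open>The completion and extensions to it\<close>

text \<open>The Banach space \<open>'l\<close> together with \<open>J\<close> is a completion of \<open>H\<close> under the seminorm
  \<open>E \<bar>\<xi>\<bar>\<close>: \<open>J\<close> is linear and isometric on \<open>H\<close> with dense image. Elements at seminorm distance
  zero are identified by \<open>J\<close>. This determines \<open>'l\<close> up to isometric isomorphism.\<close>

definition L1_completion ::
  "('w \<Rightarrow> real) set \<Rightarrow> (('w \<Rightarrow> real) \<Rightarrow> real) \<Rightarrow> (('w \<Rightarrow> real) \<Rightarrow> 'l::banach) \<Rightarrow> bool" where
  "L1_completion H E J \<longleftrightarrow>
     (\<forall>\<xi>\<in>H. \<forall>\<eta>\<in>H. J (\<lambda>\<omega>. \<xi> \<omega> + \<eta> \<omega>) = J \<xi> + J \<eta>) \<and>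
     (\<forall>c. \<forall>\<xi>\<in>H. J (\<lambda>\<omega>. c * \<xi> \<omega>) = c *\<^sub>R J \<xi>) \<and>
     (\<forall>\<xi>\<in>H. norm (J \<xi>) = E (\<lambda>\<omega>. \<bar>\<xi> \<omega>\<bar>)) \<and>
     closure (J ` H) = UNIV"

text \<open>Extensions by continuity: the value at \<open>z\<close> is the limit of the given expression in
  \<open>\<xi> \<in> H\<close> as \<open>J \<xi>\<close> tends to \<open>z\<close>.\<close>

definition L1_exp ::
  "('w \<Rightarrow> real) set \<Rightarrow> (('w \<Rightarrow> real) \<Rightarrow> 'l::banach) \<Rightarrow> (('w \<Rightarrow> real) \<Rightarrow> real) \<Rightarrow> 'l \<Rightarrow> real" where
  "L1_exp H J E z = Lim (J going_to nhds z within H) E"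

text \<open>\<open>g(z)\<close> for \<open>z\<close> in the completion, where \<open>g\<close> is a Lipschitz function such that \<open>H\<close> is closed
  under composition with \<open>g\<close>. It is used for \<open>min z N\<close> and \<open>max (z - N) 0\<close>.\<close>

definition L1_map ::
  "('w \<Rightarrow> real) set \<Rightarrow> (('w \<Rightarrow> real) \<Rightarrow> 'l::banach) \<Rightarrow> (real \<Rightarrow> real) \<Rightarrow> 'l \<Rightarrow> 'l" where
  "L1_map H J g z = Lim (J going_to nhds z within H) (\<lambda>\<xi>. J (\<lambda>\<omega>. g (\<xi> \<omega>)))"

definition vector_embed ::
  "(('w \<Rightarrow> real) \<Rightarrow> 'l::banach) \<Rightarrow> ('w \<Rightarrow> real^'d) \<Rightarrow> 'l^'d" where
  "vector_embed J \<xi> = (\<chi> i. J (\<lambda>\<omega>. \<xi> \<omega> $ i))"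

text \<open>\<open>\<phi>(X,Y)\<close> for a bounded Lipschitz function \<open>\<phi>\<close> and a random vector \<open>(X,Y)\<close> with components in
  the completion.\<close>

definition L1_apply ::
  "('w \<Rightarrow> real) set \<Rightarrow> (('w \<Rightarrow> real) \<Rightarrow> 'l::banach) \<Rightarrow> (real^'d \<Rightarrow> real^'d \<Rightarrow> real) \<Rightarrow>
   'l^'d \<Rightarrow> 'l^'d \<Rightarrow> 'l" where
  "L1_apply H J \<phi> X Y =
     Lim ((\<lambda>(\<xi>, \<eta>). (vector_embed J \<xi>, vector_embed J \<eta>)) going_to nhds (X, Y)
            within {(\<xi>, \<eta>). \<forall>i. (\<lambda>\<omega>. \<xi> \<omega> $ i) \<in> H \<and> (\<lambda>\<omega>. \<eta> \<omega> $ i) \<in> H})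
         (\<lambda>(\<xi>, \<eta>). J (\<lambda>\<omega>. \<phi> (\<xi> \<omega>) (\<eta> \<omega>)))"


section \<open>Unbounded functions of a random vector\<close>

text \<open>An element \<open>R\<close> of the completion is the random variable \<open>f(X,Y)\<close>, for a nonnegative
  unbounded \<open>f\<close>, if cutting it off at any level \<open>N\<close> gives the bounded Lipschitz function
  \<open>min(f,N)\<close> of \<open>(X,Y)\<close>. Convergence of the cut-off variables to \<open>R\<close> is not built in: that is
  what uniform integrability provides.\<close>

definition L1_represents ::
  "('w \<Rightarrow> real) set \<Rightarrow> (('w \<Rightarrow> real) \<Rightarrow> 'l::banach) \<Rightarrow> (real^'d \<Rightarrow> real^'d \<Rightarrow> real) \<Rightarrow>
   'l^'d \<Rightarrow> 'l^'d \<Rightarrow> 'l \<Rightarrow> bool" where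
  "L1_represents H J f X Y R \<longleftrightarrow>
     (\<forall>N\<ge>0. L1_map H J (\<lambda>r. min r N) R = L1_apply H J (\<lambda>x y. min (f x y) N) X Y)"

definition truncate_vec :: "real \<Rightarrow> real^'d \<Rightarrow> real^'d" where
  "truncate_vec N x = (\<chi> i. max (- N) (min N (x $ i)))"

text \<open>\<open>\<langle>A X, X\<rangle> / 2 + \<langle>p, Y\<rangle>\<close> as the limit in the completion of the same expression in the
  truncated vectors.\<close>

definition L1_quadratic ::
  "('w \<Rightarrow> real) set \<Rightarrow> (('w \<Rightarrow> real) \<Rightarrow> 'l::banach) \<Rightarrow> real^'d^'d \<Rightarrow> real^'d \<Rightarrow>
   'l^'d \<Rightarrow> 'l^'d \<Rightarrow> 'l" where
  "L1_quadratic H J A p X Y =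
     lim (\<lambda>N::nat. L1_apply H J
       (\<lambda>x y. 1/2 * ((A *v truncate_vec (real N) x) \<bullet> truncate_vec (real N) x)
               + p \<bullet> truncate_vec (real N) y) X Y)"

end

theory Submission
  imports Defs
begin

text \<open>
  Write \<open>Z\<close> for the random variable \<open>\<langle>A X, X\<rangle> / 2 + \<langle>p, Y\<rangle>\<close>.  Domination makes the extension of
  \<open>Etilde\<close> to the completion Lipschitz with constant \<open>1\<close> for the \<open>L\<^sup>1\<close> norm, so that
  \<open>f t = Etilde (t Z)\<close> is Lipschitz in the real variable \<open>t\<close>, and \<open>n f (1 / n)\<close> converges to
  \<open>G A p\<close>.  For \<open>l > 0\<close> choose integers \<open>m n\<close> with \<open>n / m n\<close> tending to \<open>l\<close>.  Then
  \<open>n f (l / n)\<close> differs from \<open>(n / m n) (m n) f (1 / m n)\<close> by at most a constant times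
  \<open>\<bar>l - n / m n\<bar>\<close>, and hence converges to \<open>l G A p\<close> (\<open>lipschitz_quotient_rescale\<close>).  For
  \<open>l = 0\<close> the claim is \<open>f 0 = 0\<close>.  It remains to know that replacing \<open>(A, p)\<close> by \<open>(l A, l p)\<close>
  replaces \<open>Z\<close> by \<open>l Z\<close> (\<open>L1_quadratic_scale\<close>).

  This last point needs the truncated expressions to converge in \<open>L\<^sup>1\<close>, since \<open>Z\<close> is defined as
  their limit.  For truncation levels \<open>N, M \<ge> 2 K\<close> two truncated expressions agree unless
  \<open>\<bar>X\<bar>\<^sup>2 > 2 K\<close> or \<open>\<bar>Y\<bar> > 2 K\<close>.  There \<open>\<bar>X\<bar>\<^sup>2 \<le> 2 (\<bar>X\<bar>\<^sup>2 - K)\<^sup>+\<close>, respectively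
  \<open>\<bar>Y\<bar> \<le> 2 (\<bar>Y\<bar> - K)\<^sup>+\<close>, so their \<open>L\<^sup>1\<close> distance is at most a constant times the quantity that
  tends to zero by uniform integrability (\<open>convergent_L1_apply_trunc_quad\<close>).

  Expressions in elements of the completion are handled through one principle: an extension by
  continuity of a Lipschitz map is computed along any sequence in \<open>H\<close> approximating its argument
  (\<open>lipschitz_going_to_Lim\<close>), which reduces inequalities in \<open>L\<^sup>1\<close> to pointwise ones on \<open>H\<close>.
\<close>

section \<open>Extension of Lipschitz maps by continuity\<close>

text \<open>The extension of \<open>f\<close> along \<open>e\<close>, a limit over a filter, can be computed along any single
  sequence whose image under \<open>e\<close> converges.  In particular the limit exists.\<close>

lemma lipschitz_going_to_Lim:
  fixes e :: "'a \<Rightarrow> 'b::metric_space" and f :: "'a \<Rightarrow> 'c::complete_space"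
  assumes lip: "\<And>u v. u \<in> S \<Longrightarrow> v \<in> S \<Longrightarrow> dist (f u) (f v) \<le> L * dist (e u) (e v)"
    and s: "\<And>k. s k \<in> S" "(\<lambda>k::nat. e (s k)) \<longlonglongrightarrow> z"
  shows "(\<lambda>k. f (s k)) \<longlonglongrightarrow> Lim (e going_to nhds z within S) f"
proof -
  let ?F = "e going_to nhds z within S"
  have lip': "dist (f u) (f v) \<le> \<bar>L\<bar> * dist (e u) (e v)" if "u \<in> S" "v \<in> S" for u v
    using lip[OF that] by (rule order_trans) (simp add: mult_right_mono)
  have "Cauchy (\<lambda>k. f (s k))"
    unfolding Cauchy_def
  proof (intro allI impI)
    fix r :: real assume "r > 0"
    have "Cauchy (\<lambda>k. e (s k))" using s(2) by (rule LIMSEQ_imp_Cauchy)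
    then obtain K where K: "\<And>m n. m \<ge> K \<Longrightarrow> n \<ge> K \<Longrightarrow> dist (e (s m)) (e (s n)) < r / (\<bar>L\<bar> + 1)"
      using \<open>r > 0\<close> unfolding Cauchy_def by (metis abs_ge_zero add_nonneg_pos divide_pos_pos zero_less_one)
    show "\<exists>K. \<forall>m\<ge>K. \<forall>n\<ge>K. dist (f (s m)) (f (s n)) < r"
    proof (intro exI allI impI)
      fix m n assume mn: "m \<ge> K" "n \<ge> K"
      have "dist (f (s m)) (f (s n)) \<le> \<bar>L\<bar> * dist (e (s m)) (e (s n))"
        by (intro lip' s)
      also have "\<dots> \<le> (\<bar>L\<bar> + 1) * dist (e (s m)) (e (s n))"
        by (intro mult_right_mono) auto
      also have "\<dots> < r"
        using K[OF mn] by (simp add: field_simps add_pos_nonneg)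
      finally show "dist (f (s m)) (f (s n)) < r" .
    qed
  qed
  then obtain l where l: "(\<lambda>k. f (s k)) \<longlonglongrightarrow> l"
    using Cauchy_convergent convergent_def by blast
  have bd: "dist (f u) l \<le> \<bar>L\<bar> * dist (e u) z" if "u \<in> S" for u
  proof (rule LIMSEQ_le)
    show "(\<lambda>k. dist (f u) (f (s k))) \<longlonglongrightarrow> dist (f u) l"
      by (intro tendsto_intros l)
    show "(\<lambda>k. \<bar>L\<bar> * dist (e u) (e (s k))) \<longlonglongrightarrow> \<bar>L\<bar> * dist (e u) z"
      by (intro tendsto_intros s)
    show "\<exists>N. \<forall>n\<ge>N. dist (f u) (f (s n)) \<le> \<bar>L\<bar> * dist (e u) (e (s n))"
      using lip' that s(1) by blast
  qed
  have e_lim: "(e \<longlongrightarrow> z) ?F"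
    unfolding going_to_within_def
    by (rule filterlim_mono[OF filterlim_filtercomap order_refl]) simp
  have "((\<lambda>u. \<bar>L\<bar> * dist (e u) z) \<longlongrightarrow> \<bar>L\<bar> * dist z z) ?F"
    by (intro tendsto_intros e_lim)
  then have "((\<lambda>u. \<bar>L\<bar> * dist (e u) z) \<longlongrightarrow> 0) ?F" by simp
  moreover have "eventually (\<lambda>u. norm (dist (f u) l) \<le> \<bar>L\<bar> * dist (e u) z) ?F"
    unfolding going_to_within_def eventually_inf_principal using bd by simp
  ultimately have "((\<lambda>u. dist (f u) l) \<longlongrightarrow> 0) ?F"
    by (rule Lim_null_comparison[rotated])
  then have f_lim: "(f \<longlongrightarrow> l) ?F" by (rule tendsto_dist_iff[THEN iffD2])
  have "?F \<noteq> bot"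
  proof
    assume "?F = bot"
    then have "eventually (\<lambda>_. False) ?F" by simp
    then obtain Q where Q: "eventually Q (nhds z)" "\<And>u. Q (e u) \<Longrightarrow> u \<notin> S"
      unfolding going_to_within_def eventually_inf_principal eventually_filtercomap by auto
    have "eventually (\<lambda>k. Q (e (s k))) sequentially"
      using s(2) Q(1) by (auto simp: filterlim_iff)
    then obtain k where "Q (e (s k))"
      by (auto simp: eventually_sequentially)
    then show False using Q(2) s(1) by blast
  qed
  then have "Lim ?F f = l" using f_lim by (rule tendsto_Lim)
  with l show ?thesis by simp
qed


section \<open>Calculus in the completion\<close>

text \<open>A sublinear expectation space \<open>(H, E)\<close> together with its completion \<open>J\<close>.\<close>

locale l1_space =
  fixes H :: "('w \<Rightarrow> real) set"
    and E :: "('w \<Rightarrow> real) \<Rightarrow> real"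
    and J :: "('w \<Rightarrow> real) \<Rightarrow> 'l::banach"
  assumes rvs: "random_variable_space H"
    and sub: "sublinear_expectation H E"
    and compl: "L1_completion H E J"
begin

lemma H_add: "\<xi> \<in> H \<Longrightarrow> \<eta> \<in> H \<Longrightarrow> (\<lambda>\<omega>. \<xi> \<omega> + \<eta> \<omega>) \<in> H"
  and H_scale: "\<xi> \<in> H \<Longrightarrow> (\<lambda>\<omega>. c * \<xi> \<omega>) \<in> H"
  and H_abs: "\<xi> \<in> H \<Longrightarrow> (\<lambda>\<omega>. \<bar>\<xi> \<omega>\<bar>) \<in> H"
  and H_comp: "\<phi> \<in> Cb_Lip n \<Longrightarrow> (\<And>i. i < n \<Longrightarrow> \<zeta> i \<in> H) \<Longrightarrow> (\<lambda>\<omega>. \<phi> (\<lambda>i. \<zeta> i \<omega>)) \<in> H"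
  using rvs unfolding random_variable_space_def by blast+

lemma H_const: "(\<lambda>_. c) \<in> H"
proof -
  have "(\<lambda>_. c) \<in> Cb_Lip 0" by (auto simp: Cb_Lip_def)
  from H_comp[OF this] show ?thesis by simp
qed

lemma H_diff: "\<xi> \<in> H \<Longrightarrow> \<eta> \<in> H \<Longrightarrow> (\<lambda>\<omega>. \<xi> \<omega> - \<eta> \<omega>) \<in> H"
  using H_add[OF _ H_scale[of \<eta> "-1"]] by simp

lemma H_excess:
  assumes "\<xi> \<in> H" shows "(\<lambda>\<omega>. max (\<xi> \<omega> - c) 0) \<in> H"
proof -
  have "(\<lambda>\<omega>. 1/2 * (\<bar>\<xi> \<omega> - c\<bar> + (\<xi> \<omega> - c))) \<in> H"
    by (intro H_scale H_add H_abs H_diff H_const assms)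
  moreover have "(\<lambda>\<omega>. 1/2 * (\<bar>\<xi> \<omega> - c\<bar> + (\<xi> \<omega> - c))) = (\<lambda>\<omega>. max (\<xi> \<omega> - c) 0)"
    by (auto simp: max_def abs_if)
  ultimately show ?thesis by simp
qed

lemma H_min:
  assumes "\<xi> \<in> H" shows "(\<lambda>\<omega>. min (\<xi> \<omega>) c) \<in> H"
proof -
  have "(\<lambda>\<omega>. \<xi> \<omega> - max (\<xi> \<omega> - c) 0) \<in> H"
    by (intro H_diff H_excess assms)
  moreover have "(\<lambda>\<omega>. \<xi> \<omega> - max (\<xi> \<omega> - c) 0) = (\<lambda>\<omega>. min (\<xi> \<omega>) c)"
    by (auto simp: max_def min_def)
  ultimately show ?thesis by simp
qed

lemma J_add: "\<xi> \<in> H \<Longrightarrow> \<eta> \<in> H \<Longrightarrow> J (\<lambda>\<omega>. \<xi> \<omega> + \<eta> \<omega>) = J \<xi> + J \<eta>"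
  and J_scale: "\<xi> \<in> H \<Longrightarrow> J (\<lambda>\<omega>. c * \<xi> \<omega>) = c *\<^sub>R J \<xi>"
  and norm_J: "\<xi> \<in> H \<Longrightarrow> norm (J \<xi>) = E (\<lambda>\<omega>. \<bar>\<xi> \<omega>\<bar>)"
  and J_dense: "closure (J ` H) = UNIV"
  using compl unfolding L1_completion_def by blast+

lemma J_diff: "\<xi> \<in> H \<Longrightarrow> \<eta> \<in> H \<Longrightarrow> J (\<lambda>\<omega>. \<xi> \<omega> - \<eta> \<omega>) = J \<xi> - J \<eta>"
  using J_add[OF _ H_scale[of \<eta> "-1"]] J_scale[of \<eta> "-1"] by simp

lemma J_zero: "J (\<lambda>_. 0) = 0"
  using J_scale[OF H_const, of 0 0] by simp

lemma E_mono: "\<xi> \<in> H \<Longrightarrow> \<eta> \<in> H \<Longrightarrow> (\<And>\<omega>. \<xi> \<omega> \<le> \<eta> \<omega>) \<Longrightarrow> E \<xi> \<le> E \<eta>"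
  using sub unfolding sublinear_expectation_def nonlinear_expectation_def by blast

lemma E_subadd: "\<xi> \<in> H \<Longrightarrow> \<eta> \<in> H \<Longrightarrow> E (\<lambda>\<omega>. \<xi> \<omega> + \<eta> \<omega>) \<le> E \<xi> + E \<eta>"
  using sub unfolding sublinear_expectation_def by simp

lemma norm_J_mono:
  assumes "\<xi> \<in> H" "\<eta> \<in> H" "\<And>\<omega>. \<bar>\<xi> \<omega>\<bar> \<le> \<eta> \<omega>"
  shows "norm (J \<xi>) \<le> norm (J \<eta>)"
  unfolding norm_J[OF assms(1)] norm_J[OF assms(2)]
  using assms(3) by (intro E_mono H_abs assms) (meson abs_ge_self order_trans)

lemma J_approx:
  obtains s where "\<And>k. s k \<in> H" "(\<lambda>k. J (s k)) \<longlonglongrightarrow> z"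
proof -
  have "z \<in> closure (J ` H)" by (simp add: J_dense)
  then obtain x where x: "\<And>k. x k \<in> J ` H" "x \<longlonglongrightarrow> z"
    unfolding closure_sequential by blast
  then have "\<forall>k. \<exists>\<xi>. \<xi> \<in> H \<and> x k = J \<xi>" by blast
  then obtain s where s: "\<And>k. s k \<in> H" "\<And>k. x k = J (s k)" by metis
  have "(\<lambda>k. J (s k)) \<longlonglongrightarrow> z" using x(2) by (simp add: s(2)[abs_def])
  with s(1) show ?thesis by (rule that)
qed

lemma dominated_lipschitz:
  assumes dom: "dominated_by H F E" and "\<xi> \<in> H" "\<eta> \<in> H"
  shows "\<bar>F \<xi> - F \<eta>\<bar> \<le> norm (J \<xi> - J \<eta>)"
proof -
  have *: "F u - F v \<le> norm (J u - J v)" if "u \<in> H" "v \<in> H" for u v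
  proof -
    have "F u - F v \<le> E (\<lambda>\<omega>. u \<omega> - v \<omega>)"
      using dom that unfolding dominated_by_def by blast
    also have "\<dots> \<le> E (\<lambda>\<omega>. \<bar>u \<omega> - v \<omega>\<bar>)"
      by (intro E_mono H_diff H_abs that) auto
    also have "\<dots> = norm (J u - J v)"
      using norm_J[OF H_diff[OF that]] J_diff[OF that] by simp
    finally show ?thesis .
  qed
  show ?thesis
    using *[OF assms(2,3)] *[OF assms(3,2)] by (simp add: norm_minus_commute abs_le_iff)
qed

lemma L1_exp_tendsto:
  assumes "dominated_by H F E" "\<And>k. s k \<in> H" "(\<lambda>k. J (s k)) \<longlonglongrightarrow> z"
  shows "(\<lambda>k. F (s k)) \<longlonglongrightarrow> L1_exp H J F z"
  unfolding L1_exp_def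
  by (rule lipschitz_going_to_Lim[where L = 1])
     (simp_all add: assms dist_norm dominated_lipschitz[OF assms(1), simplified])

lemma L1_exp_lipschitz:
  assumes dom: "dominated_by H F E"
  shows "\<bar>L1_exp H J F z - L1_exp H J F w\<bar> \<le> norm (z - w)"
proof -
  obtain s where s: "\<And>k. s k \<in> H" "(\<lambda>k. J (s k)) \<longlonglongrightarrow> z" by (rule J_approx[of z]) (rule that)
  obtain t where t: "\<And>k. t k \<in> H" "(\<lambda>k. J (t k)) \<longlonglongrightarrow> w" by (rule J_approx[of w]) (rule that)
  show ?thesis
  proof (rule LIMSEQ_le)
    show "(\<lambda>k. \<bar>F (s k) - F (t k)\<bar>) \<longlonglongrightarrow> \<bar>L1_exp H J F z - L1_exp H J F w\<bar>"
      by (intro tendsto_intros L1_exp_tendsto dom s t)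
    show "(\<lambda>k. norm (J (s k) - J (t k))) \<longlonglongrightarrow> norm (z - w)"
      by (intro tendsto_intros s t)
    show "\<exists>N. \<forall>k\<ge>N. \<bar>F (s k) - F (t k)\<bar> \<le> norm (J (s k) - J (t k))"
      by (intro exI allI impI dominated_lipschitz dom s t)
  qed
qed

lemma L1_exp_zero:
  assumes "dominated_by H F E" "nonlinear_expectation H F"
  shows "L1_exp H J F 0 = 0"
proof -
  have "(\<lambda>k::nat. F (\<lambda>_. 0)) \<longlonglongrightarrow> L1_exp H J F 0"
    by (rule L1_exp_tendsto[OF assms(1)]) (auto simp: H_const J_zero)
  moreover have "F (\<lambda>_. 0) = 0"
    using assms(2) unfolding nonlinear_expectation_def by blast
  ultimately show ?thesis by (simp add: LIMSEQ_const_iff)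
qed

lemma L1_map_tendsto:
  assumes lip: "\<And>r t. \<bar>g r - g t\<bar> \<le> \<bar>r - t\<bar>"
    and cl: "\<And>\<xi>. \<xi> \<in> H \<Longrightarrow> (\<lambda>\<omega>. g (\<xi> \<omega>)) \<in> H"
    and s: "\<And>k. s k \<in> H" "(\<lambda>k. J (s k)) \<longlonglongrightarrow> z"
  shows "(\<lambda>k. J (\<lambda>\<omega>. g (s k \<omega>))) \<longlonglongrightarrow> L1_map H J g z"
  unfolding L1_map_def
proof (rule lipschitz_going_to_Lim[where L = 1 and f = "\<lambda>\<xi>. J (\<lambda>\<omega>. g (\<xi> \<omega>))", OF _ s])
  fix u v assume uv: "u \<in> H" "v \<in> H"
  have "norm (J (\<lambda>\<omega>. g (u \<omega>) - g (v \<omega>))) \<le> norm (J (\<lambda>\<omega>. \<bar>u \<omega> - v \<omega>\<bar>))"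
    by (intro norm_J_mono H_diff H_abs cl uv lip)
  also have "\<dots> = norm (J u - J v)"
    using norm_J[OF H_abs[OF H_diff[OF uv]]] norm_J[OF H_diff[OF uv]] J_diff[OF uv] by simp
  finally show "dist (J (\<lambda>\<omega>. g (u \<omega>))) (J (\<lambda>\<omega>. g (v \<omega>))) \<le> 1 * dist (J u) (J v)"
    by (simp add: dist_norm J_diff cl uv)
qed

lemma L1_map_excess_tendsto:
  assumes "\<And>k. s k \<in> H" "(\<lambda>k. J (s k)) \<longlonglongrightarrow> z"
  shows "(\<lambda>k. J (\<lambda>\<omega>. max (s k \<omega> - c) 0)) \<longlonglongrightarrow> L1_map H J (\<lambda>r. max (r - c) 0) z"
proof (rule L1_map_tendsto[where g = "\<lambda>r. max (r - c) 0", OF _ _ assms])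
  show "\<bar>max (r - c) 0 - max (t - c) 0\<bar> \<le> \<bar>r - t\<bar>" for r t by (simp add: max_def)
qed (rule H_excess)

lemma L1_map_min_tendsto:
  assumes "\<And>k. s k \<in> H" "(\<lambda>k. J (s k)) \<longlonglongrightarrow> z"
  shows "(\<lambda>k. J (\<lambda>\<omega>. min (s k \<omega>) c)) \<longlonglongrightarrow> L1_map H J (\<lambda>r. min r c) z"
proof (rule L1_map_tendsto[where g = "\<lambda>r. min r c", OF _ _ assms])
  show "\<bar>min r c - min t c\<bar> \<le> \<bar>r - t\<bar>" for r t by (simp add: min_def)
qed (rule H_min)

lemma norm_L1_map_min_diff_le:
  assumes "K \<le> R"
  shows "norm (L1_map H J (\<lambda>r. min r R) z - L1_map H J (\<lambda>r. min r K) z)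
         \<le> norm (L1_map H J (\<lambda>r. max (r - K) 0) z)"
proof -
  obtain s where s: "\<And>k. s k \<in> H" "(\<lambda>k. J (s k)) \<longlonglongrightarrow> z" by (rule J_approx[of z]) (rule that)
  show ?thesis
  proof (rule LIMSEQ_le)
    show "(\<lambda>k. norm (J (\<lambda>\<omega>. min (s k \<omega>) R) - J (\<lambda>\<omega>. min (s k \<omega>) K))) \<longlonglongrightarrow>
       norm (L1_map H J (\<lambda>r. min r R) z - L1_map H J (\<lambda>r. min r K) z)"
      by (rule tendsto_norm[OF tendsto_diff[OF L1_map_min_tendsto[OF s] L1_map_min_tendsto[OF s]]])
    show "(\<lambda>k. norm (J (\<lambda>\<omega>. max (s k \<omega> - K) 0))) \<longlonglongrightarrow> norm (L1_map H J (\<lambda>r. max (r - K) 0) z)"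
      by (rule tendsto_norm[OF L1_map_excess_tendsto[OF s]])
    have "norm (J (\<lambda>\<omega>. min (s k \<omega>) R) - J (\<lambda>\<omega>. min (s k \<omega>) K)) \<le> norm (J (\<lambda>\<omega>. max (s k \<omega> - K) 0))" for k
    proof -
      have m: "(\<lambda>\<omega>. min (s k \<omega>) c) \<in> H" for c by (rule H_min[OF s(1)])
      have "norm (J (\<lambda>\<omega>. min (s k \<omega>) R - min (s k \<omega>) K)) \<le> norm (J (\<lambda>\<omega>. max (s k \<omega> - K) 0))"
        by (rule norm_J_mono[OF H_diff[OF m m] H_excess[OF s(1)]])
           (use assms in \<open>simp add: min_def max_def\<close>)
      then show ?thesis by (simp add: J_diff[OF m m])
    qed
    then show "\<exists>N. \<forall>k\<ge>N. norm (J (\<lambda>\<omega>. min (s k \<omega>) R) - J (\<lambda>\<omega>. min (s k \<omega>) K))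
        \<le> norm (J (\<lambda>\<omega>. max (s k \<omega> - K) 0))" by blast
  qed
qed

lemma self_dominated: "dominated_by H E E"
  unfolding dominated_by_def
proof (intro ballI)
  fix \<xi> \<eta> assume *: "\<xi> \<in> H" "\<eta> \<in> H"
  have "E (\<lambda>\<omega>. (\<xi> \<omega> - \<eta> \<omega>) + \<eta> \<omega>) \<le> E (\<lambda>\<omega>. \<xi> \<omega> - \<eta> \<omega>) + E \<eta>"
    by (rule E_subadd[OF H_diff[OF *] *(2)])
  then show "E \<xi> - E \<eta> \<le> E (\<lambda>\<omega>. \<xi> \<omega> - \<eta> \<omega>)" by simp
qed

text \<open>Elements of the form \<open>(z - K)\<^sup>+\<close> are limits of nonnegative random variables, on which \<open>E\<close> is
  the \<open>L\<^sup>1\<close> norm and is monotone.\<close>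

lemma norm_excess_le_L1_exp:
  fixes z w :: 'l and K :: real
  defines "u \<equiv> L1_map H J (\<lambda>r. max (r - K) 0) z"
    and "v \<equiv> L1_map H J (\<lambda>r. max (r - K) 0) w"
  shows "norm u \<le> L1_exp H J E (u + v)" "norm v \<le> L1_exp H J E (u + v)"
proof -
  obtain s where s: "\<And>k. s k \<in> H" "(\<lambda>k. J (s k)) \<longlonglongrightarrow> z" by (rule J_approx[of z]) (rule that)
  obtain t where t: "\<And>k. t k \<in> H" "(\<lambda>k. J (t k)) \<longlonglongrightarrow> w" by (rule J_approx[of w]) (rule that)
  let ?a = "\<lambda>k \<omega>. max (s k \<omega> - K) 0" and ?b = "\<lambda>k \<omega>. max (t k \<omega> - K) 0"
  have a: "?a k \<in> H" for k by (rule H_excess[OF s(1)])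
  have b: "?b k \<in> H" for k by (rule H_excess[OF t(1)])
  have u: "(\<lambda>k. J (?a k)) \<longlonglongrightarrow> u" and v: "(\<lambda>k. J (?b k)) \<longlonglongrightarrow> v"
    unfolding u_def v_def by (rule L1_map_excess_tendsto[OF s], rule L1_map_excess_tendsto[OF t])
  have E_lim: "(\<lambda>k. E (\<lambda>\<omega>. ?a k \<omega> + ?b k \<omega>)) \<longlonglongrightarrow> L1_exp H J E (u + v)"
  proof (rule L1_exp_tendsto[OF self_dominated H_add[OF a b]])
    show "(\<lambda>k. J (\<lambda>\<omega>. ?a k \<omega> + ?b k \<omega>)) \<longlonglongrightarrow> u + v"
      using tendsto_add[OF u v] by (simp only: J_add[OF a b])
  qed
  have "norm (J (?a k)) \<le> E (\<lambda>\<omega>. ?a k \<omega> + ?b k \<omega>)" for k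
    unfolding norm_J[OF a] by (rule E_mono[OF H_abs[OF a] H_add[OF a b]]) simp
  with LIMSEQ_le[OF tendsto_norm[OF u] E_lim] show "norm u \<le> L1_exp H J E (u + v)" by blast
  have "norm (J (?b k)) \<le> E (\<lambda>\<omega>. ?a k \<omega> + ?b k \<omega>)" for k
    unfolding norm_J[OF b] by (rule E_mono[OF H_abs[OF b] H_add[OF a b]]) simp
  with LIMSEQ_le[OF tendsto_norm[OF v] E_lim] show "norm v \<le> L1_exp H J E (u + v)" by blast
qed

end


section \<open>Bounded Lipschitz functions of a random vector\<close>

text \<open>Bounded Lipschitz functions of a pair of vectors; the norm on pairs is taken to be the sum of
  the norms.\<close>

definition bounded_lipschitz2 :: "(real^'d \<Rightarrow> real^'d \<Rightarrow> real) \<Rightarrow> bool" where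
  "bounded_lipschitz2 \<phi> \<longleftrightarrow> (\<exists>C. \<forall>x y. \<bar>\<phi> x y\<bar> \<le> C) \<and>
     (\<exists>L\<ge>0. \<forall>x y x' y'. \<bar>\<phi> x y - \<phi> x' y'\<bar> \<le> L * (norm (x - x') + norm (y - y')))"

context l1_space
begin

text \<open>The \<open>2 d\<close> coordinates of a pair of vectors are numbered by \<open>{..<n}\<close>, which turns \<open>\<phi>\<close> into an
  element of \<^const>\<open>Cb_Lip\<close>.\<close>

lemma H_bounded_lipschitz2:
  fixes \<phi> :: "real^'d \<Rightarrow> real^'d \<Rightarrow> real"
  assumes \<phi>: "bounded_lipschitz2 \<phi>"
    and \<xi>: "\<And>i. (\<lambda>\<omega>. \<xi> \<omega> $ i) \<in> H" and \<eta>: "\<And>i. (\<lambda>\<omega>. \<eta> \<omega> $ i) \<in> H"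
  shows "(\<lambda>\<omega>. \<phi> (\<xi> \<omega>) (\<eta> \<omega>)) \<in> H"
proof -
  define n where "n = card (UNIV :: ('d + 'd) set)"
  obtain h :: "nat \<Rightarrow> 'd + 'd" where h: "bij_betw h {..<n} UNIV"
    using finite_same_card_bij[of "{..<n}" "UNIV :: ('d + 'd) set"]
    by (metis card_lessThan finite finite_lessThan n_def)
  define g where "g = inv_into {..<n} h"
  have g: "g j < n" "h (g j) = j" for j
    using h unfolding g_def bij_betw_def
    by (metis UNIV_I inv_into_into lessThan_iff, metis UNIV_I f_inv_into_f)
  define \<psi> where "\<psi> v = \<phi> (\<chi> i. v (g (Inl i))) (\<chi> i. v (g (Inr i)))" for v
  obtain C where C: "\<And>x y. \<bar>\<phi> x y\<bar> \<le> C" using \<phi> unfolding bounded_lipschitz2_def by blast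
  obtain L where L: "L \<ge> 0" "\<And>x y x' y'. \<bar>\<phi> x y - \<phi> x' y'\<bar> \<le> L * (norm (x - x') + norm (y - y'))"
    using \<phi> unfolding bounded_lipschitz2_def by blast
  have "\<bar>\<psi> v - \<psi> w\<bar> \<le> (L * (2 * real CARD('d))) * L2_set (\<lambda>i. v i - w i) {..<n}" for v w
  proof -
    let ?D = "L2_set (\<lambda>i. v i - w i) {..<n}"
    have comp: "\<bar>v (g j) - w (g j)\<bar> \<le> ?D" for j
      using member_le_L2_set[of "{..<n}" "g j" "\<lambda>i. \<bar>v i - w i\<bar>"] g(1)[of j]
      by (simp add: L2_set_def)
    have "norm ((\<chi> i. v (g (k i))) - (\<chi> i. w (g (k i))) :: real^'d) \<le> real CARD('d) * ?D" for k
    proof -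
      have "norm ((\<chi> i. v (g (k i))) - (\<chi> i. w (g (k i))) :: real^'d)
          \<le> (\<Sum>i\<in>UNIV. \<bar>v (g (k i)) - w (g (k i))\<bar>)"
        by (rule order_trans[OF norm_le_l1_cart]) simp
      also have "\<dots> \<le> (\<Sum>i\<in>(UNIV::'d set). ?D)" by (intro sum_mono comp)
      finally show ?thesis by simp
    qed
    from add_mono[OF this[of Inl] this[of Inr]]
    have "\<bar>\<psi> v - \<psi> w\<bar> \<le> L * (real CARD('d) * ?D + real CARD('d) * ?D)"
      unfolding \<psi>_def by (intro order_trans[OF L(2)] mult_left_mono L(1))
    then show ?thesis by (simp add: algebra_simps)
  qed
  then have "\<psi> \<in> Cb_Lip n" using C unfolding Cb_Lip_def \<psi>_def by blast
  then have "(\<lambda>\<omega>. \<psi> (\<lambda>k. (case h k of Inl i \<Rightarrow> \<xi> \<omega> $ i | Inr i \<Rightarrow> \<eta> \<omega> $ i))) \<in> H"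
  proof (rule H_comp)
    show "(\<lambda>\<omega>. case h k of Inl i \<Rightarrow> \<xi> \<omega> $ i | Inr i \<Rightarrow> \<eta> \<omega> $ i) \<in> H" for k
      using \<xi> \<eta> by (cases "h k") simp_all
  qed
  then show ?thesis by (simp add: \<psi>_def g)
qed

text \<open>The \<open>L\<^sup>1\<close> norm of the \<open>l1\<close> distance of two random vectors is controlled by the distance of
  their embeddings.\<close>

lemma norm_vector_embed_le:
  fixes \<xi> \<xi>' :: "'w \<Rightarrow> real^'d"
  assumes "\<And>i. (\<lambda>\<omega>. \<xi> \<omega> $ i) \<in> H" "\<And>i. (\<lambda>\<omega>. \<xi>' \<omega> $ i) \<in> H"
  shows "(\<lambda>\<omega>. \<Sum>i\<in>UNIV. \<bar>\<xi> \<omega> $ i - \<xi>' \<omega> $ i\<bar>) \<in> H"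
    and "norm (J (\<lambda>\<omega>. \<Sum>i\<in>UNIV. \<bar>\<xi> \<omega> $ i - \<xi>' \<omega> $ i\<bar>))
      \<le> real CARD('d) * dist (vector_embed J \<xi>) (vector_embed J \<xi>')"
proof -
  have *: "(\<lambda>\<omega>. \<Sum>i\<in>I. \<bar>\<xi> \<omega> $ i - \<xi>' \<omega> $ i\<bar>) \<in> H \<and>
     norm (J (\<lambda>\<omega>. \<Sum>i\<in>I. \<bar>\<xi> \<omega> $ i - \<xi>' \<omega> $ i\<bar>))
      \<le> (\<Sum>i\<in>I. dist (vector_embed J \<xi> $ i) (vector_embed J \<xi>' $ i))" if "finite I" for I
    using that
  proof induction
    case empty
    then show ?case by (simp add: H_const J_zero)
  next
    case (insert i I)
    have d: "(\<lambda>\<omega>. \<xi> \<omega> $ i - \<xi>' \<omega> $ i) \<in> H" by (intro H_diff assms)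
    have "norm (J (\<lambda>\<omega>. \<bar>\<xi> \<omega> $ i - \<xi>' \<omega> $ i\<bar>)) = dist (vector_embed J \<xi> $ i) (vector_embed J \<xi>' $ i)"
      using norm_J[OF d] norm_J[OF H_abs[OF d]] J_diff[OF assms(1)[of i] assms(2)[of i]]
      by (simp add: vector_embed_def dist_norm)
    then show ?case
      using insert H_abs[OF d] by (auto simp: J_add intro!: H_add order_trans[OF norm_triangle_ineq])
  qed
  show "(\<lambda>\<omega>. \<Sum>i\<in>UNIV. \<bar>\<xi> \<omega> $ i - \<xi>' \<omega> $ i\<bar>) \<in> H" using *[of UNIV] by simp
  have "(\<Sum>i\<in>(UNIV::'d set). dist (vector_embed J \<xi> $ i) (vector_embed J \<xi>' $ i))
     \<le> (\<Sum>i\<in>(UNIV::'d set). dist (vector_embed J \<xi>) (vector_embed J \<xi>'))"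
    by (intro sum_mono dist_vec_nth_le)
  with *[of UNIV] show "norm (J (\<lambda>\<omega>. \<Sum>i\<in>UNIV. \<bar>\<xi> \<omega> $ i - \<xi>' \<omega> $ i\<bar>))
      \<le> real CARD('d) * dist (vector_embed J \<xi>) (vector_embed J \<xi>')" by simp
qed

lemma vector_embed_approx:
  fixes X :: "'l^'d"
  obtains s :: "nat \<Rightarrow> 'w \<Rightarrow> real^'d"
  where "\<And>k i. (\<lambda>\<omega>. s k \<omega> $ i) \<in> H" "(\<lambda>k. vector_embed J (s k)) \<longlonglongrightarrow> X"
proof -
  have "\<exists>s. (\<forall>k. s k \<in> H) \<and> (\<lambda>k. J (s k)) \<longlonglongrightarrow> X $ i" for i
    using J_approx[of "X $ i"] by metis
  then obtain s where s: "\<And>i k. s i k \<in> H" "\<And>i. (\<lambda>k. J (s i k)) \<longlonglongrightarrow> X $ i" by metis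
  show ?thesis
  proof (rule that[of "\<lambda>k \<omega>. \<chi> i. s i k \<omega>"])
    show "(\<lambda>k. vector_embed J (\<lambda>\<omega>. \<chi> i. s i k \<omega>)) \<longlonglongrightarrow> X"
      by (rule vec_tendstoI) (simp add: vector_embed_def s)
  qed (simp add: s)
qed

lemma L1_apply_tendsto:
  fixes X Y :: "'l^'d"
  assumes \<phi>: "bounded_lipschitz2 \<phi>"
    and s: "\<And>k i. (\<lambda>\<omega>. s k \<omega> $ i) \<in> H" "(\<lambda>k. vector_embed J (s k)) \<longlonglongrightarrow> X"
    and t: "\<And>k i. (\<lambda>\<omega>. t k \<omega> $ i) \<in> H" "(\<lambda>k. vector_embed J (t k)) \<longlonglongrightarrow> Y"
  shows "(\<lambda>k. J (\<lambda>\<omega>. \<phi> (s k \<omega>) (t k \<omega>))) \<longlonglongrightarrow> L1_apply H J \<phi> X Y"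
proof -
  let ?e = "\<lambda>(\<xi>, \<eta>). (vector_embed J \<xi> :: 'l^'d, vector_embed J \<eta> :: 'l^'d)"
  let ?f = "\<lambda>(\<xi>, \<eta>). J (\<lambda>\<omega>. \<phi> (\<xi> \<omega>) (\<eta> \<omega>))"
  let ?S = "{(\<xi>, \<eta>). \<forall>i::'d. (\<lambda>\<omega>. \<xi> \<omega> $ i) \<in> H \<and> (\<lambda>\<omega>. \<eta> \<omega> $ i) \<in> H}"
  obtain L where L: "L \<ge> 0" "\<And>x y x' y'. \<bar>\<phi> x y - \<phi> x' y'\<bar> \<le> L * (norm (x - x') + norm (y - y'))"
    using \<phi> unfolding bounded_lipschitz2_def by blast
  have lip: "dist (?f u) (?f v) \<le> (L * (2 * real CARD('d))) * dist (?e u) (?e v)"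
    if "u \<in> ?S" "v \<in> ?S" for u v
  proof -
    obtain a b a' b' where uv: "u = (a, b)" "v = (a', b')" by fastforce
    have H: "\<And>i. (\<lambda>\<omega>. a \<omega> $ i) \<in> H" "\<And>i. (\<lambda>\<omega>. b \<omega> $ i) \<in> H"
       "\<And>i. (\<lambda>\<omega>. a' \<omega> $ i) \<in> H" "\<And>i. (\<lambda>\<omega>. b' \<omega> $ i) \<in> H"
      using that unfolding uv by auto
    let ?p = "\<lambda>\<omega>. \<Sum>i\<in>UNIV. \<bar>a \<omega> $ i - a' \<omega> $ i\<bar>" and ?q = "\<lambda>\<omega>. \<Sum>i\<in>UNIV. \<bar>b \<omega> $ i - b' \<omega> $ i\<bar>"
    note p = norm_vector_embed_le[OF H(1,3)] and q = norm_vector_embed_le[OF H(2,4)]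
    have 1: "(\<lambda>\<omega>. \<phi> (a \<omega>) (b \<omega>)) \<in> H" and 2: "(\<lambda>\<omega>. \<phi> (a' \<omega>) (b' \<omega>)) \<in> H"
      using H_bounded_lipschitz2[OF \<phi>] H by auto
    have "dist (?f u) (?f v) = norm (J (\<lambda>\<omega>. \<phi> (a \<omega>) (b \<omega>) - \<phi> (a' \<omega>) (b' \<omega>)))"
      unfolding J_diff[OF 1 2] uv by (simp add: dist_norm)
    also have "\<dots> \<le> norm (J (\<lambda>\<omega>. L * (?p \<omega> + ?q \<omega>)))"
    proof (intro norm_J_mono H_diff H_scale H_add 1 2 p q)
      fix \<omega>
      have "norm (a \<omega> - a' \<omega>) \<le> ?p \<omega>" "norm (b \<omega> - b' \<omega>) \<le> ?q \<omega>"
        by (rule order_trans[OF norm_le_l1_cart], simp)+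
      then show "\<bar>\<phi> (a \<omega>) (b \<omega>) - \<phi> (a' \<omega>) (b' \<omega>)\<bar> \<le> L * (?p \<omega> + ?q \<omega>)"
        by (intro order_trans[OF L(2)] mult_left_mono L(1) add_mono)
    qed
    also have "\<dots> = L * norm (J ?p + J ?q)"
      using L(1) by (simp add: J_scale H_add J_add p(1) q(1))
    also have "\<dots> \<le> L * (real CARD('d) * dist (vector_embed J a) (vector_embed J a')
                    + real CARD('d) * dist (vector_embed J b) (vector_embed J b'))"
      by (intro mult_left_mono L(1) order_trans[OF norm_triangle_ineq] add_mono p q)
    also have "\<dots> \<le> L * (real CARD('d) * dist (?e u) (?e v) + real CARD('d) * dist (?e u) (?e v))"
      unfolding uv prod.case
      using dist_fst_le[of "(vector_embed J a, vector_embed J b)" "(vector_embed J a', vector_embed J b')"]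
        dist_snd_le[of "(vector_embed J a, vector_embed J b)" "(vector_embed J a', vector_embed J b')"]
      by (intro mult_left_mono L(1) add_mono) auto
    finally show ?thesis by (simp add: algebra_simps)
  qed
  have "(\<lambda>k. ?f (s k, t k)) \<longlonglongrightarrow> Lim (?e going_to nhds (X, Y) within ?S) ?f"
    by (rule lipschitz_going_to_Lim[OF lip]) (use s t in \<open>auto intro!: tendsto_Pair\<close>)
  then show ?thesis by (simp add: L1_apply_def)
qed

lemma L1_apply_scale:
  fixes X Y :: "'l^'d"
  assumes "bounded_lipschitz2 \<phi>" "bounded_lipschitz2 (\<lambda>x y. c * \<phi> x y)"
  shows "L1_apply H J (\<lambda>x y. c * \<phi> x y) X Y = c *\<^sub>R L1_apply H J \<phi> X Y"
proof -
  obtain s where s: "\<And>k i. (\<lambda>\<omega>. s k \<omega> $ i) \<in> H" "(\<lambda>k. vector_embed J (s k)) \<longlonglongrightarrow> X"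
    by (rule vector_embed_approx[of X]) (rule that)
  obtain t where t: "\<And>k i. (\<lambda>\<omega>. t k \<omega> $ i) \<in> H" "(\<lambda>k. vector_embed J (t k)) \<longlonglongrightarrow> Y"
    by (rule vector_embed_approx[of Y]) (rule that)
  have "(\<lambda>k. J (\<lambda>\<omega>. c * \<phi> (s k \<omega>) (t k \<omega>))) \<longlonglongrightarrow> L1_apply H J (\<lambda>x y. c * \<phi> x y) X Y"
    by (rule L1_apply_tendsto[OF assms(2) s t])
  moreover have "(\<lambda>k. c *\<^sub>R J (\<lambda>\<omega>. \<phi> (s k \<omega>) (t k \<omega>))) \<longlonglongrightarrow> c *\<^sub>R L1_apply H J \<phi> X Y"
    by (intro tendsto_intros L1_apply_tendsto[OF assms(1) s t])
  ultimately show ?thesis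
    by (simp add: J_scale H_bounded_lipschitz2[OF assms(1)] s t LIMSEQ_unique)
qed

text \<open>A pointwise bound between bounded Lipschitz functions passes to the completion.\<close>

lemma norm_L1_apply_diff_le:
  fixes X Y :: "'l^'d"
  assumes bl: "bounded_lipschitz2 \<phi>1" "bounded_lipschitz2 \<phi>2" "bounded_lipschitz2 f1"
      "bounded_lipschitz2 f2" "bounded_lipschitz2 g1" "bounded_lipschitz2 g2"
    and c: "c \<ge> 0"
    and le: "\<And>x y. \<bar>\<phi>1 x y - \<phi>2 x y\<bar> \<le> c * ((f1 x y - f2 x y) + (g1 x y - g2 x y))"
  shows "norm (L1_apply H J \<phi>1 X Y - L1_apply H J \<phi>2 X Y)
     \<le> c * (norm (L1_apply H J f1 X Y - L1_apply H J f2 X Y)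
          + norm (L1_apply H J g1 X Y - L1_apply H J g2 X Y))"
proof -
  obtain s where s: "\<And>k i. (\<lambda>\<omega>. s k \<omega> $ i) \<in> H" "(\<lambda>k. vector_embed J (s k)) \<longlonglongrightarrow> X"
    by (rule vector_embed_approx[of X]) (rule that)
  obtain t where t: "\<And>k i. (\<lambda>\<omega>. t k \<omega> $ i) \<in> H" "(\<lambda>k. vector_embed J (t k)) \<longlonglongrightarrow> Y"
    by (rule vector_embed_approx[of Y]) (rule that)
  define V where "V \<phi> k = (\<lambda>\<omega>. \<phi> (s k \<omega>) (t k \<omega>))" for \<phi> :: "real^'d \<Rightarrow> real^'d \<Rightarrow> real" and k
  have VH: "V \<phi> k \<in> H" if "bounded_lipschitz2 \<phi>" for \<phi> k
    unfolding V_def by (rule H_bounded_lipschitz2[OF that s(1) t(1)])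
  have V: "(\<lambda>k. J (V \<phi> k)) \<longlonglongrightarrow> L1_apply H J \<phi> X Y" if "bounded_lipschitz2 \<phi>" for \<phi>
    unfolding V_def by (rule L1_apply_tendsto[OF that s t])
  show ?thesis
  proof (rule LIMSEQ_le)
    show "(\<lambda>k. norm (J (V \<phi>1 k) - J (V \<phi>2 k))) \<longlonglongrightarrow> norm (L1_apply H J \<phi>1 X Y - L1_apply H J \<phi>2 X Y)"
      by (intro tendsto_intros V bl)
    show "(\<lambda>k. c * (norm (J (V f1 k) - J (V f2 k)) + norm (J (V g1 k) - J (V g2 k)))) \<longlonglongrightarrow>
       c * (norm (L1_apply H J f1 X Y - L1_apply H J f2 X Y)
          + norm (L1_apply H J g1 X Y - L1_apply H J g2 X Y))"
      by (intro tendsto_intros V bl)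
    have "norm (J (V \<phi>1 k) - J (V \<phi>2 k))
        \<le> c * (norm (J (V f1 k) - J (V f2 k)) + norm (J (V g1 k) - J (V g2 k)))" for k
    proof -
      have "norm (J (V \<phi>1 k) - J (V \<phi>2 k)) = norm (J (\<lambda>\<omega>. V \<phi>1 k \<omega> - V \<phi>2 k \<omega>))"
        by (simp add: J_diff VH bl)
      also have "\<dots> \<le> norm (J (\<lambda>\<omega>. c * ((V f1 k \<omega> - V f2 k \<omega>) + (V g1 k \<omega> - V g2 k \<omega>))))"
        by (intro norm_J_mono H_diff H_scale H_add VH bl) (simp add: V_def le)
      also have "\<dots> = c * norm ((J (V f1 k) - J (V f2 k)) + (J (V g1 k) - J (V g2 k)))"
        using c by (simp add: J_scale J_add J_diff H_add H_diff VH bl)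
      also have "\<dots> \<le> c * (norm (J (V f1 k) - J (V f2 k)) + norm (J (V g1 k) - J (V g2 k)))"
        by (intro mult_left_mono norm_triangle_ineq c)
      finally show ?thesis .
    qed
    then show "\<exists>N. \<forall>k\<ge>N. norm (J (V \<phi>1 k) - J (V \<phi>2 k))
        \<le> c * (norm (J (V f1 k) - J (V f2 k)) + norm (J (V g1 k) - J (V g2 k)))" by blast
  qed
qed

end


section \<open>Truncated quadratic forms\<close>

lemma truncate_vec_id:
  assumes "norm x \<le> N" shows "truncate_vec N x = x"
proof -
  have "\<bar>x $ i\<bar> \<le> N" for i using component_le_norm_cart[of x i] assms by simp
  then have "- N \<le> x $ i \<and> x $ i \<le> N" for i by (simp add: abs_le_iff minus_le_iff)
  then have "max (- N) (min N (x $ i)) = x $ i" for i by (simp add: min_absorb2 max_absorb2)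
  then show ?thesis by (simp add: truncate_vec_def vec_eq_iff)
qed

lemma norm_truncate_vec_le:
  assumes "N \<ge> 0" shows "norm (truncate_vec N x) \<le> norm x"
  by (rule norm_le_componentwise_cart) (use assms in \<open>auto simp: truncate_vec_def\<close>)

lemma norm_truncate_vec_bound:
  assumes "N \<ge> 0" shows "norm (truncate_vec N (x :: real^'d)) \<le> real CARD('d) * N"
proof -
  have "norm (truncate_vec N x) \<le> (\<Sum>i\<in>UNIV. \<bar>truncate_vec N x $ i\<bar>)" by (rule norm_le_l1_cart)
  also have "\<dots> \<le> (\<Sum>i\<in>(UNIV::'d set). N)"
    by (intro sum_mono) (use assms in \<open>auto simp: truncate_vec_def\<close>)
  finally show ?thesis by simp
qed

lemma truncate_vec_lipschitz:
  "norm (truncate_vec N x - truncate_vec N y) \<le> norm (x - y)"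
  by (rule norm_le_componentwise_cart) (auto simp: truncate_vec_def)

text \<open>The function of two vectors whose value at \<open>(X, Y)\<close> is the \<open>N\<close>-th term of the sequence
  defining \<^const>\<open>L1_quadratic\<close>.\<close>

definition trunc_quad :: "real^'d^'d \<Rightarrow> real^'d \<Rightarrow> nat \<Rightarrow> real^'d \<Rightarrow> real^'d \<Rightarrow> real" where
  "trunc_quad A p N x y = 1/2 * ((A *v truncate_vec (real N) x) \<bullet> truncate_vec (real N) x)
               + p \<bullet> truncate_vec (real N) y"

lemma trunc_quad_scale: "trunc_quad (c *\<^sub>R A) (c *\<^sub>R p) N x y = c * trunc_quad A p N x y"
  by (simp add: trunc_quad_def scaleR_matrix_vector_assoc[symmetric] algebra_simps)

lemma matrix_form_bound:
  fixes A :: "real^'d^'d"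
  obtains B where "B \<ge> 0" "\<And>x y. \<bar>(A *v x) \<bullet> y\<bar> \<le> B * norm x * norm y"
proof -
  obtain B where B: "B > 0" "\<And>x. norm (A *v x) \<le> norm x * B"
    using bounded_linear.pos_bounded[OF matrix_vector_mul_bounded_linear[of A]] by blast
  have "\<bar>(A *v x) \<bullet> y\<bar> \<le> B * norm x * norm y" for x y
    by (rule order_trans[OF Cauchy_Schwarz_ineq2])
       (rule mult_right_mono, use B(2)[of x] in \<open>simp_all add: mult.commute\<close>)
  with B(1) that show ?thesis by (meson less_imp_le)
qed

lemma bounded_lipschitz2_trunc_quad: "bounded_lipschitz2 (trunc_quad (A :: real^'d^'d) p N)"
proof -
  obtain B where B: "B \<ge> 0" "\<And>x y. \<bar>(A *v x) \<bullet> y\<bar> \<le> B * norm x * norm y"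
    by (rule matrix_form_bound[of A]) (rule that)
  let ?T = "truncate_vec (real N) :: real^'d \<Rightarrow> real^'d"
  define M where "M = real CARD('d) * real N"
  have M: "norm (?T x) \<le> M" "M \<ge> 0" for x
    unfolding M_def using norm_truncate_vec_bound[of "real N" x] by simp_all
  have "\<bar>trunc_quad A p N x y\<bar> \<le> B * M * M + norm p * M" for x y
  proof -
    have "\<bar>(A *v ?T x) \<bullet> ?T x\<bar> \<le> B * M * M"
      by (rule order_trans[OF B(2)]) (intro mult_mono M B(1) mult_nonneg_nonneg norm_ge_zero order_refl)
    moreover have "\<bar>p \<bullet> ?T y\<bar> \<le> norm p * M"
      by (rule order_trans[OF Cauchy_Schwarz_ineq2]) (intro mult_left_mono M norm_ge_zero)
    ultimately show ?thesis unfolding trunc_quad_def by (simp add: abs_le_iff)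
  qed
  moreover have "\<bar>trunc_quad A p N x y - trunc_quad A p N x' y'\<bar>
      \<le> (B * M + norm p) * (norm (x - x') + norm (y - y'))" for x y x' y'
  proof -
    have eq: "trunc_quad A p N x y - trunc_quad A p N x' y' =
       1/2 * ((A *v (?T x - ?T x')) \<bullet> ?T x + (A *v ?T x') \<bullet> (?T x - ?T x')) + p \<bullet> (?T y - ?T y')"
      unfolding trunc_quad_def
      by (simp add: matrix_vector_mult_diff_distrib inner_diff_left inner_diff_right algebra_simps)
    have "\<bar>(A *v (?T x - ?T x')) \<bullet> ?T x\<bar> \<le> B * norm (x - x') * M"
      by (rule order_trans[OF B(2)])
         (intro mult_mono M B(1) truncate_vec_lipschitz mult_nonneg_nonneg norm_ge_zero order_refl)
    moreover have "\<bar>(A *v ?T x') \<bullet> (?T x - ?T x')\<bar> \<le> B * M * norm (x - x')"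
      by (rule order_trans[OF B(2)])
         (intro mult_mono M B(1) truncate_vec_lipschitz mult_nonneg_nonneg norm_ge_zero order_refl)
    moreover have "\<bar>p \<bullet> (?T y - ?T y')\<bar> \<le> norm p * norm (y - y')"
      by (rule order_trans[OF Cauchy_Schwarz_ineq2])
         (intro mult_left_mono truncate_vec_lipschitz norm_ge_zero)
    ultimately have "\<bar>trunc_quad A p N x y - trunc_quad A p N x' y'\<bar>
        \<le> B * M * norm (x - x') + norm p * norm (y - y')"
      unfolding eq by (simp add: abs_le_iff algebra_simps)
    also have "\<dots> \<le> (B * M + norm p) * (norm (x - x') + norm (y - y'))"
      using B(1) M(2) by (simp add: algebra_simps)
    finally show ?thesis .
  qed
  moreover have "B * M + norm p \<ge> 0" using B(1) M(2) by simp
  ultimately show ?thesis unfolding bounded_lipschitz2_def by blast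
qed

lemma bounded_lipschitz2_min_norm_sq:
  assumes "R \<ge> 0"
  shows "bounded_lipschitz2 (\<lambda>(x::real^'d) (y::real^'d). min ((norm x)\<^sup>2) R)"
proof -
  define r where "r = sqrt R"
  have r: "r \<ge> 0" "R = r\<^sup>2" using assms by (auto simp: r_def)
  have eq: "min (a\<^sup>2) R = (min a r)\<^sup>2" if "a \<ge> 0" for a
    using that r by (auto simp: min_def)
  have *: "\<bar>min ((norm x)\<^sup>2) R - min ((norm x')\<^sup>2) R\<bar> \<le> (2 * r) * (norm (x - x') + norm (y - y'))"
    for x x' y y' :: "real^'d"
  proof -
    let ?a = "min (norm x) r" and ?b = "min (norm x') r"
    have "\<bar>min ((norm x)\<^sup>2) R - min ((norm x')\<^sup>2) R\<bar> = \<bar>?a + ?b\<bar> * \<bar>?a - ?b\<bar>"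
      unfolding eq[OF norm_ge_zero] by (simp add: power2_eq_square abs_mult[symmetric] algebra_simps)
    also have "\<dots> \<le> (2 * r) * (norm (x - x') + norm (y - y'))"
    proof (intro mult_mono)
      show "\<bar>?a + ?b\<bar> \<le> 2 * r" using r(1) by (auto simp: min_def)
      have "\<bar>?a - ?b\<bar> \<le> \<bar>norm x - norm x'\<bar>" by (auto simp: min_def)
      also have "\<dots> \<le> norm (x - x')" by (rule norm_triangle_ineq3)
      finally show "\<bar>?a - ?b\<bar> \<le> norm (x - x') + norm (y - y')" by (simp add: add_increasing2)
    qed (use r in auto)
    finally show ?thesis .
  qed
  have "\<forall>x y::real^'d. \<bar>min ((norm x)\<^sup>2) R\<bar> \<le> R" using assms by (auto simp: min_def)
  moreover have "2 * r \<ge> 0" using r by simp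
  ultimately show ?thesis unfolding bounded_lipschitz2_def using * by blast
qed

lemma bounded_lipschitz2_min_norm:
  assumes "R \<ge> 0"
  shows "bounded_lipschitz2 (\<lambda>(x::real^'d) (y::real^'d). min (norm y) R)"
proof -
  have "\<bar>min (norm y) R - min (norm y') R\<bar> \<le> 1 * (norm (x - x') + norm (y - y'))"
    for x x' y y' :: "real^'d"
  proof -
    have "\<bar>min (norm y) R - min (norm y') R\<bar> \<le> \<bar>norm y - norm y'\<bar>" by (auto simp: min_def)
    also have "\<dots> \<le> norm (y - y')" by (rule norm_triangle_ineq3)
    finally show ?thesis by (simp add: add_increasing)
  qed
  moreover have "\<forall>x y::real^'d. \<bar>min (norm y) R\<bar> \<le> R" using assms by (auto simp: min_def)
  ultimately show ?thesis unfolding bounded_lipschitz2_def by (meson zero_le_one)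
qed

text \<open>The scalar estimate behind the Cauchy property.  In its applications \<open>n\<close> is \<open>\<bar>x\<bar>\<^sup>2\<close> or
  \<open>\<bar>y\<bar>\<close>, \<open>K\<close> is the level of uniform integrability, and \<open>a, b\<close> are the same expressions in the
  vector truncated at two levels.  The cap \<open>R\<close> keeps the right-hand side bounded; it is harmless
  once it exceeds \<open>K\<close> by at least \<open>a\<close> and \<open>b\<close>.\<close>

lemma trunc_diff_bound:
  fixes a b K R n :: real
  assumes "0 \<le> a" "0 \<le> b" "0 \<le> K" "K \<le> R" "0 \<le> n" "a \<le> n" "b \<le> n" "a \<le> R - K" "b \<le> R - K" "2 * K < n"
  shows "a + b \<le> 4 * (min n R - min n K)"
  using assms by (auto simp: min_def)

lemma trunc_quad_diff_le:
  fixes A :: "real^'d^'d"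
  assumes B: "B \<ge> 0" "\<And>x y. \<bar>(A *v x) \<bullet> y\<bar> \<le> B * norm x * norm y"
    and K: "1 \<le> K" "2 * K \<le> N" "2 * K \<le> M"
    and R: "R \<ge> real K + (real CARD('d) * max (real N) (real M)) + (real CARD('d) * max (real N) (real M))\<^sup>2"
  shows "\<bar>trunc_quad A p N x y - trunc_quad A p M x y\<bar>
     \<le> (2 * B + 4 * norm p) * ((min ((norm x)\<^sup>2) R - min ((norm x)\<^sup>2) (real K))
          + (min (norm y) R - min (norm y) (real K)))"
proof -
  let ?T = "\<lambda>N. truncate_vec (real N) :: real^'d \<Rightarrow> real^'d"
  define D where "D = real CARD('d) * max (real N) (real M)"
  have D: "D \<ge> 0" "norm (?T N x) \<le> D" "norm (?T M x) \<le> D" for x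
  proof -
    show "D \<ge> 0" by (simp add: D_def)
    have "real CARD('d) * real N \<le> D" "real CARD('d) * real M \<le> D"
      unfolding D_def by (intro mult_left_mono; simp)+
    then show "norm (?T N x) \<le> D" "norm (?T M x) \<le> D"
      using norm_truncate_vec_bound[of "real N" x] norm_truncate_vec_bound[of "real M" x] by auto
  qed
  have RD: "real K \<le> R" "D \<le> R - K" "D\<^sup>2 \<le> R - K"
    using R D(1) zero_le_power2[of D] unfolding D_def[symmetric] by linarith+
  let ?f = "min ((norm x)\<^sup>2) R - min ((norm x)\<^sup>2) (real K)" and ?g = "min (norm y) R - min (norm y) (real K)"
  have fg: "?f \<ge> 0" "?g \<ge> 0" using RD(1) by (auto simp: min_def)
  have 1: "\<bar>(A *v ?T N x) \<bullet> ?T N x - (A *v ?T M x) \<bullet> ?T M x\<bar> \<le> B * (4 * ?f)"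
  proof (cases "(norm x)\<^sup>2 \<le> 2 * real K")
    case True
    \<comment> \<open>As \<open>2 K \<ge> 1\<close>, the bound on \<open>\<bar>x\<bar>\<^sup>2\<close> gives \<open>\<bar>x\<bar> \<le> 2 K\<close>, and no component is cut off.\<close>
    have "2 * real K \<le> (2 * real K)\<^sup>2" using K(1) by (simp add: power2_eq_square)
    with True have "(norm x)\<^sup>2 \<le> (2 * real K)\<^sup>2" by (rule order_trans)
    then have "norm x \<le> 2 * real K" by (rule power2_le_imp_le) simp
    then have "norm x \<le> real N" "norm x \<le> real M" using K by linarith+
    then have eq: "?T N x = x" "?T M x = x" by (simp_all add: truncate_vec_id)
    have "0 \<le> B * (4 * ?f)" by (intro mult_nonneg_nonneg B(1) fg(1)) simp
    then show ?thesis unfolding eq by (simp only: diff_self abs_zero)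
  next
    case False
    have "\<bar>(A *v ?T N x) \<bullet> ?T N x - (A *v ?T M x) \<bullet> ?T M x\<bar> \<le> B * ((norm (?T N x))\<^sup>2 + (norm (?T M x))\<^sup>2)"
      using B(2)[of "?T N x" "?T N x"] B(2)[of "?T M x" "?T M x"]
      unfolding power2_eq_square distrib_left mult.assoc by linarith
    also have "\<dots> \<le> B * (4 * ?f)"
    proof (rule mult_left_mono[OF trunc_diff_bound B(1)])
      show "(norm (?T N x))\<^sup>2 \<le> (norm x)\<^sup>2" "(norm (?T M x))\<^sup>2 \<le> (norm x)\<^sup>2"
        by (intro power_mono norm_truncate_vec_le; simp)+
      have "(norm (?T N x))\<^sup>2 \<le> D\<^sup>2" "(norm (?T M x))\<^sup>2 \<le> D\<^sup>2"
        by (intro power_mono D; simp)+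
      then show "(norm (?T N x))\<^sup>2 \<le> R - K" "(norm (?T M x))\<^sup>2 \<le> R - K" using RD(3) by auto
    qed (use False RD in auto)
    finally show ?thesis .
  qed
  have 2: "\<bar>p \<bullet> ?T N y - p \<bullet> ?T M y\<bar> \<le> norm p * (4 * ?g)"
  proof (cases "norm y \<le> 2 * real K")
    case True
    then have "norm y \<le> real N" "norm y \<le> real M" using K by linarith+
    then have eq: "?T N y = y" "?T M y = y" by (simp_all add: truncate_vec_id)
    have "0 \<le> norm p * (4 * ?g)" by (intro mult_nonneg_nonneg norm_ge_zero fg(2)) simp
    then show ?thesis unfolding eq by (simp only: diff_self abs_zero)
  next
    case False
    have "\<bar>p \<bullet> ?T N y - p \<bullet> ?T M y\<bar> \<le> norm p * (norm (?T N y) + norm (?T M y))"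
      using Cauchy_Schwarz_ineq2[of p "?T N y"] Cauchy_Schwarz_ineq2[of p "?T M y"]
      unfolding distrib_left by linarith
    also have "\<dots> \<le> norm p * (4 * ?g)"
    proof (rule mult_left_mono[OF trunc_diff_bound norm_ge_zero])
      show "norm (?T N y) \<le> norm y" "norm (?T M y) \<le> norm y"
        by (intro norm_truncate_vec_le; simp)+
      show "norm (?T N y) \<le> R - K" "norm (?T M y) \<le> R - K" using D(2,3)[of y] RD by auto
    qed (use False RD in auto)
    finally show ?thesis .
  qed
  have "\<bar>trunc_quad A p N x y - trunc_quad A p M x y\<bar> \<le> 1/2 * (B * (4 * ?f)) + norm p * (4 * ?g)"
    using 1 2 unfolding trunc_quad_def abs_le_iff by linarith
  also have "\<dots> \<le> 1/2 * (B * (4 * ?f)) + norm p * (4 * ?g) + (2 * (B * ?g) + 4 * (norm p * ?f))"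
    using mult_nonneg_nonneg[OF B(1) fg(2)] mult_nonneg_nonneg[OF norm_ge_zero[of p] fg(1)] by linarith
  also have "\<dots> = (2 * B + 4 * norm p) * (?f + ?g)" by (simp only: algebra_simps)
  finally show ?thesis .
qed

context l1_space
begin

text \<open>Only the capped functions \<open>min (\<bar>x\<bar>\<^sup>2) R\<close> and \<open>min \<bar>y\<bar> R\<close> are tied to \<open>X_sq\<close> and \<open>Y_abs\<close>,
  so the cap \<open>R\<close> is chosen for each pair \<open>N, M\<close>.  The resulting bound depends on \<open>K\<close> alone.\<close>

lemma convergent_L1_apply_trunc_quad:
  fixes X Y :: "'l^'d"
  assumes X_sq: "L1_represents H J (\<lambda>x y. (norm x)\<^sup>2) X Y X_sq"
    and Y_abs: "L1_represents H J (\<lambda>x y. norm y) X Y Y_abs"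
    and ui: "(\<lambda>N::nat. L1_exp H J E
          (L1_map H J (\<lambda>r. max (r - real N) 0) X_sq + L1_map H J (\<lambda>r. max (r - real N) 0) Y_abs))
        \<longlonglongrightarrow> 0"
  shows "convergent (\<lambda>N. L1_apply H J (trunc_quad A p N) X Y)"
proof -
  obtain B where B: "B \<ge> 0" "\<And>x y. \<bar>(A *v x) \<bullet> y\<bar> \<le> B * norm x * norm y"
    by (rule matrix_form_bound[of A]) (rule that)
  define c where "c = 2 * B + 4 * norm p"
  have c: "c \<ge> 0" using B(1) by (simp add: c_def)
  define \<epsilon> where "\<epsilon> K = L1_exp H J E
    (L1_map H J (\<lambda>r. max (r - real K) 0) X_sq + L1_map H J (\<lambda>r. max (r - real K) 0) Y_abs)" for K :: nat
  let ?Z = "\<lambda>N. L1_apply H J (trunc_quad A p N) X Y"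
  have bound: "norm (?Z N - ?Z M) \<le> c * (\<epsilon> K + \<epsilon> K)" if K: "1 \<le> K" "2 * K \<le> N" "2 * K \<le> M" for K N M
  proof -
    define R where "R = real K + (real CARD('d) * max (real N) (real M)) + (real CARD('d) * max (real N) (real M))\<^sup>2"
    have R: "real K \<le> R" "0 \<le> R" by (auto simp: R_def intro!: add_nonneg_nonneg)
    have "norm (?Z N - ?Z M) \<le>
      c * (norm (L1_apply H J (\<lambda>x y. min ((norm x)\<^sup>2) R) X Y - L1_apply H J (\<lambda>x y. min ((norm x)\<^sup>2) (real K)) X Y)
         + norm (L1_apply H J (\<lambda>x y. min (norm y) R) X Y - L1_apply H J (\<lambda>x y. min (norm y) (real K)) X Y))"
      by (rule norm_L1_apply_diff_le[OF bounded_lipschitz2_trunc_quad bounded_lipschitz2_trunc_quad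
            bounded_lipschitz2_min_norm_sq bounded_lipschitz2_min_norm_sq
            bounded_lipschitz2_min_norm bounded_lipschitz2_min_norm c])
         (use R(2) trunc_quad_diff_le[OF B K, of R p] in \<open>simp_all add: c_def R_def\<close>)
    also have "\<dots> = c * (norm (L1_map H J (\<lambda>r. min r R) X_sq - L1_map H J (\<lambda>r. min r (real K)) X_sq)
         + norm (L1_map H J (\<lambda>r. min r R) Y_abs - L1_map H J (\<lambda>r. min r (real K)) Y_abs))"
      using X_sq Y_abs R(2) unfolding L1_represents_def by simp
    also have "\<dots> \<le> c * (\<epsilon> K + \<epsilon> K)"
      unfolding \<epsilon>_def
      using norm_L1_map_min_diff_le[OF R(1), of X_sq] norm_excess_le_L1_exp(1)[of "real K" X_sq Y_abs]
        norm_L1_map_min_diff_le[OF R(1), of Y_abs] norm_excess_le_L1_exp(2)[of "real K" Y_abs X_sq]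
      by (intro mult_left_mono[OF add_mono c]) (rule order_trans; assumption)+
    finally show ?thesis .
  qed
  have "(\<lambda>K. c * (\<epsilon> K + \<epsilon> K)) \<longlonglongrightarrow> c * (0 + 0)"
    using ui unfolding \<epsilon>_def by (intro tendsto_intros)
  then have lim: "(\<lambda>K. c * (\<epsilon> K + \<epsilon> K)) \<longlonglongrightarrow> 0" by simp
  have "Cauchy ?Z"
  proof (rule CauchyI)
    fix r :: real assume "r > 0"
    from order_tendstoD(2)[OF lim this]
    obtain K0 where K0: "\<And>K. K \<ge> K0 \<Longrightarrow> c * (\<epsilon> K + \<epsilon> K) < r"
      unfolding eventually_sequentially by blast
    define K where "K = max 1 K0"
    show "\<exists>n0. \<forall>m\<ge>n0. \<forall>n\<ge>n0. norm (?Z m - ?Z n) < r"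
    proof (intro exI allI impI)
      fix m n assume "m \<ge> 2 * K" "n \<ge> 2 * K"
      then have "norm (?Z m - ?Z n) \<le> c * (\<epsilon> K + \<epsilon> K)" by (intro bound) (auto simp: K_def)
      also have "\<dots> < r" by (rule K0) (simp add: K_def)
      finally show "norm (?Z m - ?Z n) < r" .
    qed
  qed
  then show ?thesis by (rule Cauchy_convergent)
qed

text \<open>Convergence is essential here: \<^const>\<open>lim\<close> of a divergent sequence is an arbitrary value,
  which does not scale.\<close>

lemma L1_quadratic_scale:
  fixes X Y :: "'l^'d"
  assumes "L1_represents H J (\<lambda>x y. (norm x)\<^sup>2) X Y X_sq"
    and "L1_represents H J (\<lambda>x y. norm y) X Y Y_abs"
    and "(\<lambda>N::nat. L1_exp H J E
          (L1_map H J (\<lambda>r. max (r - real N) 0) X_sq + L1_map H J (\<lambda>r. max (r - real N) 0) Y_abs))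
        \<longlonglongrightarrow> 0"
  shows "L1_quadratic H J (c *\<^sub>R A) (c *\<^sub>R p) X Y = c *\<^sub>R L1_quadratic H J A p X Y"
proof -
  have quad: "L1_quadratic H J A p X Y = lim (\<lambda>N. L1_apply H J (trunc_quad A p N) X Y)" for A p
    by (simp add: L1_quadratic_def trunc_quad_def[abs_def])
  have "L1_apply H J (trunc_quad (c *\<^sub>R A) (c *\<^sub>R p) N) X Y = c *\<^sub>R L1_apply H J (trunc_quad A p N) X Y" for N
  proof -
    have eq: "trunc_quad (c *\<^sub>R A) (c *\<^sub>R p) N = (\<lambda>x y. c * trunc_quad A p N x y)"
      by (intro ext trunc_quad_scale)
    show ?thesis
      unfolding eq
      by (intro L1_apply_scale bounded_lipschitz2_trunc_quad)
         (use bounded_lipschitz2_trunc_quad[of "c *\<^sub>R A" "c *\<^sub>R p" N] in \<open>simp add: eq\<close>)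
  qed
  moreover have "(\<lambda>N. c *\<^sub>R L1_apply H J (trunc_quad A p N) X Y) \<longlonglongrightarrow> c *\<^sub>R L1_quadratic H J A p X Y"
    unfolding quad
    by (intro tendsto_intros convergent_LIMSEQ_iff[THEN iffD1] convergent_L1_apply_trunc_quad[OF assms])
  ultimately show ?thesis unfolding quad[of "c *\<^sub>R A"] by (simp add: limI)
qed

end


section \<open>Limits along rescaled reciprocals\<close>

text \<open>The hypothesis concerns \<open>f\<close> only at the points \<open>1 / n\<close>; the Lipschitz bound transfers it to the
  points \<open>l / n\<close> through the nearby reciprocals \<open>1 / m n\<close>.\<close>

lemma lipschitz_quotient_rescale:
  fixes f :: "real \<Rightarrow> real"
  assumes lip: "\<And>s t. \<bar>f s - f t\<bar> \<le> C * \<bar>s - t\<bar>"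
    and lim: "(\<lambda>n::nat. real n * f (1 / real n)) \<longlonglongrightarrow> g"
    and l: "l > 0"
  shows "(\<lambda>n::nat. real n * f (l / real n)) \<longlonglongrightarrow> l * g"
proof -
  define m where "m n = nat \<lceil>real n / l\<rceil>" for n
  have m: "real n / l \<le> real (m n)" "real (m n) \<le> real n / l + 1" for n
  proof -
    have "real (m n) = of_int \<lceil>real n / l\<rceil>" using l by (simp add: m_def)
    then show "real n / l \<le> real (m n)" "real (m n) \<le> real n / l + 1"
      using ceiling_correct[of "real n / l"] by linarith+
  qed
  have ratio: "(\<lambda>n. real (m n) / real n) \<longlonglongrightarrow> 1 / l"
  proof (rule tendsto_sandwich)
    show "\<forall>\<^sub>F n in sequentially. 1 / l \<le> real (m n) / real n"
      using eventually_gt_at_top[of 0]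
      by eventually_elim (use m(1) l in \<open>simp add: field_simps\<close>)
    show "\<forall>\<^sub>F n in sequentially. real (m n) / real n \<le> 1 / l + 1 / real n"
      using eventually_gt_at_top[of 0]
      by eventually_elim (use m(2) l in \<open>simp add: field_simps\<close>)
    have "(\<lambda>n. 1 / l + 1 / real n) \<longlonglongrightarrow> 1 / l + 0"
      by (intro tendsto_intros lim_1_over_n)
    then show "(\<lambda>n. 1 / l + 1 / real n) \<longlonglongrightarrow> 1 / l" by simp
  qed simp
  have "(\<lambda>n. inverse (real (m n) / real n)) \<longlonglongrightarrow> inverse (1 / l)"
    by (intro tendsto_inverse ratio) (use l in simp)
  then have q: "(\<lambda>n. real n / real (m n)) \<longlonglongrightarrow> l" by (simp add: inverse_eq_divide)
  have "filterlim (\<lambda>n. real n * (1 / l)) at_top sequentially"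
    by (rule filterlim_at_top_mult_tendsto_pos[OF tendsto_const _ filterlim_real_sequentially])
       (use l in simp)
  then have "filterlim (\<lambda>n. real (m n)) at_top sequentially"
    by (rule filterlim_at_top_mono) (use m(1) in simp)
  then have "filterlim m at_top sequentially"
    by (simp add: filterlim_sequentially_iff_filterlim_real)
  then have "(\<lambda>n. real (m n) * f (1 / real (m n))) \<longlonglongrightarrow> g"
    by (rule filterlim_compose[OF lim])
  from tendsto_mult[OF q this]
  have main: "(\<lambda>n. real n / real (m n) * (real (m n) * f (1 / real (m n)))) \<longlonglongrightarrow> l * g" .
  have "(\<lambda>n. C * \<bar>l - real n / real (m n)\<bar>) \<longlonglongrightarrow> C * \<bar>l - l\<bar>"
    by (intro tendsto_intros q)
  then have err: "(\<lambda>n. C * \<bar>l - real n / real (m n)\<bar>) \<longlonglongrightarrow> 0" by simp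
  have "(\<lambda>n. real n * f (l / real n) - real n / real (m n) * (real (m n) * f (1 / real (m n)))) \<longlonglongrightarrow> 0"
  proof (rule Lim_null_comparison[OF _ err])
    show "\<forall>\<^sub>F n in sequentially. norm (real n * f (l / real n)
        - real n / real (m n) * (real (m n) * f (1 / real (m n)))) \<le> C * \<bar>l - real n / real (m n)\<bar>"
      using eventually_gt_at_top[of 0]
    proof eventually_elim
      fix n :: nat assume n: "n > 0"
      have "real n / l > 0" using n l by simp
      then have mpos: "real (m n) > 0" using m(1)[of n] by linarith
      have "norm (real n * f (l / real n) - real n / real (m n) * (real (m n) * f (1 / real (m n))))
         = real n * \<bar>f (l / real n) - f (1 / real (m n))\<bar>"
        using mpos by (simp add: right_diff_distrib[symmetric] abs_mult)
      also have "\<dots> \<le> real n * (C * \<bar>l / real n - 1 / real (m n)\<bar>)"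
        by (intro mult_left_mono lip) simp
      also have "\<dots> = C * \<bar>real n * (l / real n - 1 / real (m n))\<bar>"
        by (simp add: abs_mult)
      also have "\<dots> = C * \<bar>l - real n / real (m n)\<bar>"
        using n by (simp add: right_diff_distrib)
      finally show "norm (real n * f (l / real n)
        - real n / real (m n) * (real (m n) * f (1 / real (m n)))) \<le> C * \<bar>l - real n / real (m n)\<bar>" .
    qed
  qed
  from tendsto_add[OF this main] show ?thesis by simp
qed


section \<open>Positive homogeneity of the limit\<close>

theorem proposition4p3:
  fixes H :: "('w \<Rightarrow> real) set"
    and Ehat Etilde :: "('w \<Rightarrow> real) \<Rightarrow> real"
    and J :: "('w \<Rightarrow> real) \<Rightarrow> 'l::banach"
    and X Y :: "'l^'d"
    and X_sq Y_abs :: 'l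
    and G :: "real^'d^'d \<Rightarrow> real^'d \<Rightarrow> real"
  assumes "random_variable_space H"
    and "sublinear_expectation H Ehat"
    and "nonlinear_expectation H Etilde"
    and "dominated_by H Etilde Ehat"
    and "L1_completion H Ehat J"
    and "L1_represents H J (\<lambda>x y. (norm x)\<^sup>2) X Y X_sq"
    and "L1_represents H J (\<lambda>x y. norm y) X Y Y_abs"
    and uniform_integrability:
      "(\<lambda>N::nat. L1_exp H J Ehat
          (L1_map H J (\<lambda>r. max (r - real N) 0) X_sq + L1_map H J (\<lambda>r. max (r - real N) 0) Y_abs))
        \<longlonglongrightarrow> 0"
    and G_limit:
      "\<And>A p. transpose A = A \<Longrightarrow>
        (\<lambda>n::nat. real n * L1_exp H J Etilde ((1 / real n) *\<^sub>R L1_quadratic H J A p X Y))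
          \<longlonglongrightarrow> G A p"
  shows "\<forall>A p. transpose A = A \<longrightarrow>
           (\<forall>l\<ge>0. G (l *\<^sub>R A) (l *\<^sub>R p) = l * G A p)"
proof (intro allI impI)
  fix A :: "real^'d^'d" and p :: "real^'d" and l :: real
  assume sym: "transpose A = A" and l: "l \<ge> 0"
  interpret l1_space H Ehat J
    using assms(1,2,5) by unfold_locales
  note dom = assms(4)
  define f where "f t = L1_exp H J Etilde (t *\<^sub>R L1_quadratic H J A p X Y)" for t
  have quad: "L1_quadratic H J (l *\<^sub>R A) (l *\<^sub>R p) X Y = l *\<^sub>R L1_quadratic H J A p X Y"
    by (rule L1_quadratic_scale[OF assms(6,7) uniform_integrability])
  have "transpose (l *\<^sub>R A) = l *\<^sub>R A"
    using sym by (simp add: transpose_def vec_eq_iff)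
  from G_limit[OF this, of "l *\<^sub>R p"]
  have lhs: "(\<lambda>n. real n * f (l / real n)) \<longlonglongrightarrow> G (l *\<^sub>R A) (l *\<^sub>R p)"
    by (simp add: quad f_def)
  have lim: "(\<lambda>n. real n * f (1 / real n)) \<longlonglongrightarrow> G A p"
    using G_limit[OF sym, of p] by (simp add: f_def)
  show "G (l *\<^sub>R A) (l *\<^sub>R p) = l * G A p"
  proof (cases "l = 0")
    case True
    have "f 0 = 0" using L1_exp_zero[OF dom assms(3)] by (simp add: f_def)
    then show ?thesis using lhs True by (simp add: LIMSEQ_const_iff)
  next
    case False
    have "\<bar>f s - f t\<bar> \<le> norm (L1_quadratic H J A p X Y) * \<bar>s - t\<bar>" for s t
      using L1_exp_lipschitz[OF dom, of "s *\<^sub>R L1_quadratic H J A p X Y" "t *\<^sub>R L1_quadratic H J A p X Y"]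
      unfolding f_def by (simp add: scaleR_left_diff_distrib[symmetric] mult.commute)
    then have "(\<lambda>n. real n * f (l / real n)) \<longlonglongrightarrow> l * G A p"
      by (rule lipschitz_quotient_rescale[OF _ lim]) (use l False in simp)
    with lhs show ?thesis by (rule LIMSEQ_unique)
  qed
qed

end
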